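(* Let $\mathrm{H}:\mathbf{Top}_0\to\mathbf{Set}$ be an R-subset system, and let $X$ and $Y$ be two $T_0$ spaces. Then the following two conditions are equivalent: (1) $Y$ is $\mathrm{H}$-sober. (2) The set $\mathbb{C}(X,Y)$ of all continuous functions from $X$ to $Y$, equipped with the topology of pointwise convergence, is $\mathrm{H}$-sober.
   Context: $\mathbf{Top}_0$ is the category of $T_0$ spaces and continuous maps; $\mathbf{Set}$ is the category of sets and maps. For a $T_0$ space $X$, a nonempty subset $A\subseteq X$ is irreducible if for any closed sets $F_1,F_2$, $A\subseteq F_1\cup F_2$ implies $A\subseteq F_1$ or $A\subseteq F_2$; $\mathsf{Irr}(X)$ is the set of all irreducible subsets of $X$. An R-subset system (irreducible subset system) is a covariant functor $\mathrm{H}:\mathbf{Top}_0\to\mathbf{Set}$ such that (i) for each $T_0$ space $X$, $\{\{x\}:x\in X\}\subseteq \mathrm{H}(X)\subseteq \mathsf{Irr}(X)$; (ii) for each continuous map $f:X\to Y$ of $T_0$ spaces and each $A\in\mathrm{H}(X)$, $\mathrm{H}(f)(A)=f(A)\in \mathrm{H}(Y)$. A $T_0$ space $X$ is $\mathrm{H}$-sober if for every $A\in\mathrm{H}(X)$ there is a (necessarily unique) point $x\in X$ with $\overline{A}=\overline{\{x\}}$. The topology of pointwise convergence on $\mathbb{C}(X,Y)$ has as a subbasis the sets $S(x,U)=\{f\in\mathbb{C}(X,Y): f(x)\in U\}$, with $x\in X$ and $U$ open in $Y$.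
   Formalization: The space X is assumed to be nonempty; for empty X the function space is a single point, hence H-sober, while Y need not be H-sober. *)

theory Defs
  imports "HOL-Analysis.Analysis"
begin

text \<open>
  HOL has no type of all spaces, so the category of \<open>T\<^sub>0\<close> spaces is rendered relative to a
  universe type \<open>'u\<close>: its objects are the \<open>T\<^sub>0\<close> topologies on subsets of \<open>'u\<close>. Statements are
  polymorphic in \<open>'u\<close>, and lemma \<open>universe_exists\<close> below shows that any two given spaces, together
  with their function space, occur up to homeomorphism in a common universe.
\<close>

definition irreducible_in :: "'u topology \<Rightarrow> 'u set \<Rightarrow> bool" where
  "irreducible_in X A \<longleftrightarrow> A \<subseteq> topspace X \<and> A \<noteq> {} \<and>
     (\<forall>F1 F2. closedin X F1 \<and> closedin X F2 \<and> A \<subseteq> F1 \<union> F2 \<longrightarrow> A \<subseteq> F1 \<or> A \<subseteq> F2)"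

definition Irr :: "'u topology \<Rightarrow> 'u set set" where
  "Irr X = {A. irreducible_in X A}"

text \<open>
  A set-valued functor consists of an object part \<open>H\<close> and a morphism part \<open>Hm\<close>, where \<open>Hm X Y f\<close> is
  the image of the morphism \<open>f\<close> from \<open>X\<close> to \<open>Y\<close>. HOL functions agreeing on \<open>topspace X\<close> represent
  the same morphism out of \<open>X\<close>, hence the second clause; likewise only the values of \<open>Hm X Y f\<close>
  on \<open>H X\<close> matter.
\<close>

definition Top0_Set_functor ::
  "('u topology \<Rightarrow> 's set) \<Rightarrow> ('u topology \<Rightarrow> 'u topology \<Rightarrow> ('u \<Rightarrow> 'u) \<Rightarrow> 's \<Rightarrow> 's) \<Rightarrow> bool" where
  "Top0_Set_functor H Hm \<longleftrightarrow>
     (\<forall>X Y f. t0_space X \<and> t0_space Y \<and> continuous_map X Y f \<longrightarrow> Hm X Y f \<in> H X \<rightarrow> H Y) \<and>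
     (\<forall>X Y f g. t0_space X \<and> t0_space Y \<and> continuous_map X Y f \<and> continuous_map X Y g \<and>
        (\<forall>x\<in>topspace X. f x = g x) \<longrightarrow> (\<forall>a\<in>H X. Hm X Y f a = Hm X Y g a)) \<and>
     (\<forall>X. t0_space X \<longrightarrow> (\<forall>a\<in>H X. Hm X X id a = a)) \<and>
     (\<forall>X Y Z f g. t0_space X \<and> t0_space Y \<and> t0_space Z \<and>
        continuous_map X Y f \<and> continuous_map Y Z g \<longrightarrow>
        (\<forall>a\<in>H X. Hm X Z (g \<circ> f) a = Hm Y Z g (Hm X Y f a)))"

definition R_subset_system ::
  "('u topology \<Rightarrow> 'u set set) \<Rightarrow>
   ('u topology \<Rightarrow> 'u topology \<Rightarrow> ('u \<Rightarrow> 'u) \<Rightarrow> 'u set \<Rightarrow> 'u set) \<Rightarrow> bool" where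
  "R_subset_system H Hm \<longleftrightarrow>
     Top0_Set_functor H Hm \<and>
     (\<forall>X. t0_space X \<longrightarrow> {{x} |x. x \<in> topspace X} \<subseteq> H X \<and> H X \<subseteq> Irr X) \<and>
     (\<forall>X Y f. t0_space X \<and> t0_space Y \<and> continuous_map X Y f \<longrightarrow>
        (\<forall>A\<in>H X. Hm X Y f A = f ` A \<and> f ` A \<in> H Y))"

definition H_sober :: "('u topology \<Rightarrow> 'u set set) \<Rightarrow> 'u topology \<Rightarrow> bool" where
  "H_sober H X \<longleftrightarrow> t0_space X \<and>
     (\<forall>A\<in>H X. \<exists>x\<in>topspace X. X closure_of A = X closure_of {x})"

text \<open>
  Continuous maps are represented by functions that are \<open>undefined\<close> outside \<open>topspace X\<close>, so that
  each map is counted once.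
\<close>

definition cmaps :: "'a topology \<Rightarrow> 'b topology \<Rightarrow> ('a \<Rightarrow> 'b) set" where
  "cmaps X Y = {f \<in> extensional (topspace X). continuous_map X Y f}"

definition pointwise_topology :: "'a topology \<Rightarrow> 'b topology \<Rightarrow> ('a \<Rightarrow> 'b) topology" where
  "pointwise_topology X Y =
     topology (arbitrary union_of
       (finite intersection_of
          (\<lambda>S. \<exists>x\<in>topspace X. \<exists>U. openin Y U \<and> S = {f \<in> cmaps X Y. f x \<in> U})
        relative_to cmaps X Y))"

lemma topspace_pointwise_topology [simp]: "topspace (pointwise_topology X Y) = cmaps X Y"
  by (simp add: pointwise_topology_def)

lemma homeomorphic_copy_exists:
  fixes Z :: "'z topology" and e :: "'z \<Rightarrow> 'u"
  assumes e: "inj_on e (topspace Z)"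
  shows "\<exists>U :: 'u topology. topspace U = e ` topspace Z \<and> homeomorphic_map Z U e"
proof -
  let ?g = "inv_into (topspace Z) e"
  define U where "U = pullback_topology (e ` topspace Z) ?g Z"
  have top: "topspace U = e ` topspace Z"
    unfolding U_def topspace_pullback_topology using e by (auto simp: inv_into_into)
  have "continuous_map Z U e"
    unfolding U_def
  proof (rule continuous_map_pullback')
    show "continuous_map Z Z (?g \<circ> e)"
      by (rule continuous_map_eq [OF continuous_map_id]) (simp add: e)
  qed auto
  moreover have "continuous_map U Z ?g"
    unfolding U_def using continuous_map_pullback [OF continuous_map_id, of _ ?g Z] by simp
  ultimately have "homeomorphic_maps Z U e ?g"
    unfolding homeomorphic_maps_def using e top by (auto simp: f_inv_into_f)
  then show ?thesis
    using top homeomorphic_maps_map by blast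
qed

lemma universe_exists:
  fixes X :: "'a topology" and Y :: "'b topology"
  shows "\<exists>(X' :: ('a + 'b + ('a \<Rightarrow> 'b)) topology) (Y' :: ('a + 'b + ('a \<Rightarrow> 'b)) topology) (C :: ('a + 'b + ('a \<Rightarrow> 'b)) topology).
           X' homeomorphic_space X \<and> Y' homeomorphic_space Y \<and>
           C homeomorphic_space pointwise_topology X' Y'"
proof -
  let ?i = "Inl :: 'a \<Rightarrow> 'a + 'b + ('a \<Rightarrow> 'b)"
  let ?j = "Inr \<circ> Inl :: 'b \<Rightarrow> 'a + 'b + ('a \<Rightarrow> 'b)"
  have inj: "inj_on ?i (topspace X)" "inj ?j" "inj_on ?j (topspace Y)"
    by (auto simp: inj_on_def)
  obtain X' where X': "topspace X' = ?i ` topspace X" "homeomorphic_map X X' ?i"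
    using homeomorphic_copy_exists [OF inj(1)] by blast
  obtain Y' where Y': "topspace Y' = ?j ` topspace Y" "homeomorphic_map Y Y' ?j"
    using homeomorphic_copy_exists [OF inj(3)] by blast
  let ?e = "\<lambda>f. Inr (Inr (\<lambda>a. inv ?j (f (?i a)))) :: 'a + 'b + ('a \<Rightarrow> 'b)"
  have "inj_on ?e (topspace (pointwise_topology X' Y'))"
  proof (rule inj_onI)
    fix f g
    assume f: "f \<in> topspace (pointwise_topology X' Y')"
      and g: "g \<in> topspace (pointwise_topology X' Y')" and eq: "?e f = ?e g"
    have fg: "f \<in> extensional (topspace X')" "g \<in> extensional (topspace X')"
      "f \<in> topspace X' \<rightarrow> topspace Y'" "g \<in> topspace X' \<rightarrow> topspace Y'"
      using f g by (auto simp: cmaps_def continuous_map_def)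
    show "f = g"
    proof (rule extensionalityI [OF fg(1,2)])
      fix x assume x: "x \<in> topspace X'"
      then obtain a where a: "x = ?i a" using X'(1) by blast
      have "inv ?j (f x) = inv ?j (g x)"
        using eq a by (auto dest: fun_cong)
      moreover have "f x \<in> range ?j" "g x \<in> range ?j"
        using fg(3,4) x Y'(1) by blast+
      ultimately show "f x = g x"
        by (metis f_inv_into_f)
    qed
  qed
  then obtain C where "homeomorphic_map (pointwise_topology X' Y') C ?e"
    using homeomorphic_copy_exists by blast
  then have "C homeomorphic_space pointwise_topology X' Y'"
    using homeomorphic_map_imp_homeomorphic_space homeomorphic_space_sym by blast
  moreover have "X' homeomorphic_space X" "Y' homeomorphic_space Y"
    using X'(2) Y'(2) homeomorphic_map_imp_homeomorphic_space homeomorphic_space_sym by blast+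
  ultimately show ?thesis
    by blast
qed

end

theory Submission
  imports Defs
begin

text \<open>
  A point \<open>x\<close> satisfies \<open>closure {x} = closure A\<close> iff it lies in exactly those open sets that meet
  \<open>A\<close>; call it generic for \<open>A\<close>. Continuous maps preserve genericity. Constant maps and evaluation
  at a point make \<open>Y\<close> a retract of the function space, which gives one direction. Conversely, for
  \<open>A\<close> in \<open>H (C(X,Y))\<close> let \<open>f x\<close> be generic for the set of values \<open>g x\<close> with \<open>g \<in> A\<close>. The preimage
  of an open set under \<open>f\<close> is the union of its preimages under the members of \<open>A\<close>, so \<open>f\<close> is
  continuous; it is generic for \<open>A\<close> on subbasic open sets by construction, and on finite
  intersections of them because \<open>A\<close> is irreducible.
\<close>

section \<open>Generic points and irreducible sets\<close>

definition generic_in :: "'a topology \<Rightarrow> 'a set \<Rightarrow> 'a \<Rightarrow> bool" where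
  "generic_in X A x \<longleftrightarrow> (\<forall>U. openin X U \<longrightarrow> (x \<in> U \<longleftrightarrow> A \<inter> U \<noteq> {}))"

text \<open>By minimality of closures, equality of the two closures amounts to \<open>A\<close>
  lying in the closure of \<open>x\<close> and \<open>x\<close> in the closure of \<open>A\<close>.
  Written with open sets, these are the two directions of genericity.\<close>

lemma generic_in_iff_closure_of:
  assumes "x \<in> topspace X" "A \<subseteq> topspace X"
  shows "generic_in X A x \<longleftrightarrow> X closure_of A = X closure_of {x}"
proof -
  have "X closure_of A = X closure_of {x} \<longleftrightarrow> A \<subseteq> X closure_of {x} \<and> x \<in> X closure_of A"
    using assms closure_of_subset [of A X] closure_of_subset [of "{x}" X]
      closure_of_minimal [OF _ closedin_closure_of, of A X "{x}"]
      closure_of_minimal [OF _ closedin_closure_of, of "{x}" X A] by auto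
  also have "A \<subseteq> X closure_of {x} \<longleftrightarrow> (\<forall>U. openin X U \<longrightarrow> A \<inter> U \<noteq> {} \<longrightarrow> x \<in> U)"
    using assms(2) unfolding subset_iff in_closure_of by blast
  also have "x \<in> X closure_of A \<longleftrightarrow> (\<forall>U. openin X U \<longrightarrow> x \<in> U \<longrightarrow> A \<inter> U \<noteq> {})"
    using assms(1) unfolding in_closure_of by blast
  also have "(\<forall>U. openin X U \<longrightarrow> A \<inter> U \<noteq> {} \<longrightarrow> x \<in> U) \<and>
      (\<forall>U. openin X U \<longrightarrow> x \<in> U \<longrightarrow> A \<inter> U \<noteq> {}) \<longleftrightarrow> generic_in X A x"
    unfolding generic_in_def by blast
  finally show ?thesis ..
qed

lemma generic_in_continuous_image:
  assumes "continuous_map X Y f" "x \<in> topspace X" "A \<subseteq> topspace X" "generic_in X A x"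
  shows "generic_in Y (f ` A) (f x)"
  unfolding generic_in_def
proof (intro allI impI)
  fix U assume "openin Y U"
  then have "openin X {z \<in> topspace X. f z \<in> U}"
    using assms(1) by (simp add: openin_continuous_map_preimage)
  then have "x \<in> {z \<in> topspace X. f z \<in> U} \<longleftrightarrow> A \<inter> {z \<in> topspace X. f z \<in> U} \<noteq> {}"
    using assms(4) unfolding generic_in_def by blast
  then show "f x \<in> U \<longleftrightarrow> f ` A \<inter> U \<noteq> {}"
    using assms(2,3) by blast
qed

lemma irreducible_in_subset: "irreducible_in X A \<Longrightarrow> A \<subseteq> topspace X"
  unfolding irreducible_in_def by (elim conjE)

text \<open>Irreducibility passed to complements, in the form that handles finite intersections of
  subbasic open sets.\<close>

lemma irreducible_in_openin_Int:
  assumes "irreducible_in X A" "openin X U" "openin X V" "A \<inter> U \<noteq> {}" "A \<inter> V \<noteq> {}"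
  shows "A \<inter> (U \<inter> V) \<noteq> {}"
proof
  assume "A \<inter> (U \<inter> V) = {}"
  then have "A \<subseteq> (topspace X - U) \<union> (topspace X - V)"
    using assms(1) by (auto simp: irreducible_in_def)
  moreover have "closedin X (topspace X - U)" "closedin X (topspace X - V)"
    using assms(2,3) by auto
  ultimately have "A \<subseteq> topspace X - U \<or> A \<subseteq> topspace X - V"
    using assms(1) unfolding irreducible_in_def by blast
  then show False
    using assms(4,5) by blast
qed

lemma irreducible_in_continuous_image:
  assumes "continuous_map X Y f" "irreducible_in X A"
  shows "irreducible_in Y (f ` A)"
  unfolding irreducible_in_def
proof (intro conjI allI impI)
  show "f ` A \<subseteq> topspace Y" "f ` A \<noteq> {}"
    using assms by (auto simp: irreducible_in_def continuous_map_def)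
next
  fix F1 F2 assume F: "closedin Y F1 \<and> closedin Y F2 \<and> f ` A \<subseteq> F1 \<union> F2"
  let ?p = "\<lambda>F. {x \<in> topspace X. f x \<in> F}"
  have "closedin X (?p F1)" "closedin X (?p F2)"
    using F assms(1) by (auto intro: closedin_continuous_map_preimage)
  moreover have "A \<subseteq> ?p F1 \<union> ?p F2"
    using F assms(2) by (auto simp: irreducible_in_def)
  ultimately have "A \<subseteq> ?p F1 \<or> A \<subseteq> ?p F2"
    using assms(2) unfolding irreducible_in_def by blast
  then show "f ` A \<subseteq> F1 \<or> f ` A \<subseteq> F2"
    by blast
qed

section \<open>The topology of pointwise convergence\<close>

lemma openin_pointwise_topology_subbasis:
  assumes "x \<in> topspace X" "openin Y U"
  shows "openin (pointwise_topology X Y) {f \<in> cmaps X Y. f x \<in> U}"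
proof -
  let ?P = "\<lambda>S. \<exists>x\<in>topspace X. \<exists>U. openin Y U \<and> S = {f \<in> cmaps X Y. f x \<in> U}"
  have "?P {f \<in> cmaps X Y. f x \<in> U}"
    using assms by blast
  then have "(finite intersection_of ?P relative_to cmaps X Y) {f \<in> cmaps X Y. f x \<in> U}"
    unfolding relative_to_def
    by (intro exI [of _ "{f \<in> cmaps X Y. f x \<in> U}"] conjI finite_intersection_of_inc) auto
  then show ?thesis
    unfolding pointwise_topology_def openin_subbase by (rule arbitrary_union_of_inc)
qed

text \<open>Reduces a claim about all open sets to subbasic ones. The case \<open>Space\<close>
  accounts for the empty intersection; the case \<open>Int\<close> offers openness of both sets
  because irreducibility speaks only of open sets.\<close>

lemma openin_pointwise_topology_induct [consumes 1, case_names Subbasis Space Int Union]: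
  assumes "openin (pointwise_topology X Y) W"
    and subbasis: "\<And>x U. x \<in> topspace X \<Longrightarrow> openin Y U \<Longrightarrow> Q {f \<in> cmaps X Y. f x \<in> U}"
    and space: "Q (cmaps X Y)"
    and int: "\<And>S T. openin (pointwise_topology X Y) S \<Longrightarrow> openin (pointwise_topology X Y) T \<Longrightarrow>
                Q S \<Longrightarrow> Q T \<Longrightarrow> Q (S \<inter> T)"
    and union: "\<And>\<S>. (\<And>S. S \<in> \<S> \<Longrightarrow> Q S) \<Longrightarrow> Q (\<Union>\<S>)"
  shows "Q W"
proof -
  let ?P = "\<lambda>S. \<exists>x\<in>topspace X. \<exists>U. openin Y U \<and> S = {f \<in> cmaps X Y. f x \<in> U}"
  \<comment> \<open>Openness is carried through the induction together with \<open>Q\<close>, since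
    \<open>int\<close> asks for both.\<close>
  have fin: "openin (pointwise_topology X Y) (cmaps X Y \<inter> \<Inter>\<T>) \<and> Q (cmaps X Y \<inter> \<Inter>\<T>)"
    if "finite \<T>" "\<T> \<subseteq> Collect ?P" for \<T>
    using that
  proof (induction \<T> rule: finite_induct)
    case empty
    then show ?case
      using space openin_topspace [of "pointwise_topology X Y"] by simp
  next
    case (insert S \<T>)
    then have "openin (pointwise_topology X Y) S" "Q S"
      using openin_pointwise_topology_subbasis subbasis by auto
    moreover have "cmaps X Y \<inter> \<Inter>(insert S \<T>) = S \<inter> (cmaps X Y \<inter> \<Inter>\<T>)"
      by blast
    ultimately show ?case
      using insert int by auto
  qed
  obtain \<U> where U: "\<U> \<subseteq> Collect (finite intersection_of ?P relative_to cmaps X Y)" "\<Union>\<U> = W"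
    using assms(1) unfolding pointwise_topology_def openin_subbase by (auto simp: union_of_def)
  have "Q (\<Union>\<U>)"
  proof (rule union)
    fix S assume "S \<in> \<U>"
    then show "Q S"
      using U(1) fin by (auto simp: relative_to_def intersection_of_def)
  qed
  then show ?thesis
    using U(2) by simp
qed

lemma continuous_map_pointwise_eval:
  assumes "x \<in> topspace X"
  shows "continuous_map (pointwise_topology X Y) Y (\<lambda>f. f x)"
  unfolding continuous_map_def topspace_pointwise_topology
proof (intro conjI allI impI funcsetI)
  show "f x \<in> topspace Y" if "f \<in> cmaps X Y" for f
    using that assms by (auto simp: cmaps_def continuous_map_def)
qed (rule openin_pointwise_topology_subbasis [OF assms])

text \<open>The section of every evaluation map: a subbasic set given by \<open>x\<close> and
  \<open>U\<close> pulls back to \<open>U\<close> itself, whatever \<open>x\<close> is.\<close>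

lemma continuous_map_pointwise_const:
  "continuous_map Y (pointwise_topology X Y) (\<lambda>y. \<lambda>x\<in>topspace X. y)"
proof -
  have const: "(\<lambda>x\<in>topspace X. y) \<in> cmaps X Y" if "y \<in> topspace Y" for y
    using that continuous_map_eq [of X Y "\<lambda>_. y" "\<lambda>x\<in>topspace X. y"] by (simp add: cmaps_def)
  have "openin Y {y \<in> topspace Y. (\<lambda>x\<in>topspace X. y) \<in> {f \<in> cmaps X Y. f x \<in> U}}"
    if "x \<in> topspace X" "openin Y U" for x U
  proof -
    have "{y \<in> topspace Y. (\<lambda>x\<in>topspace X. y) \<in> {f \<in> cmaps X Y. f x \<in> U}} = U"
      using const that openin_subset [OF that(2)] by auto
    then show ?thesis
      using that by simp
  qed
  then show ?thesis
    unfolding pointwise_topology_def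
    by (intro continuous_map_into_topology_subbase) (auto simp only: topspace_subbase const)
qed

lemma t0_space_pointwise_topology:
  assumes "t0_space Y"
  shows "t0_space (pointwise_topology X Y)"
  unfolding t0_space_def topspace_pointwise_topology
proof (intro ballI impI)
  fix f g assume fg: "f \<in> cmaps X Y" "g \<in> cmaps X Y" "f \<noteq> g"
  \<comment> \<open>Members of \<open>cmaps X Y\<close> agree outside \<open>topspace X\<close>, so
    distinct ones differ at a point of \<open>X\<close>, where \<open>Y\<close> separates their
    values.\<close>
  then obtain x where x: "x \<in> topspace X" "f x \<noteq> g x"
    using extensionalityI [of f "topspace X" g] by (auto simp: cmaps_def)
  then have "f x \<in> topspace Y" "g x \<in> topspace Y"
    using fg by (auto simp: cmaps_def continuous_map_def)
  then obtain U where "openin Y U" "f x \<notin> U \<longleftrightarrow> g x \<in> U"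
    using assms x(2) unfolding t0_space_def by blast
  then show "\<exists>W. openin (pointwise_topology X Y) W \<and> (f \<notin> W \<longleftrightarrow> g \<in> W)"
    using openin_pointwise_topology_subbasis [OF x(1)] fg by blast
qed

section \<open>Generic functions assembled pointwise\<close>

lemma continuous_map_pointwise_generic:
  assumes "A \<subseteq> cmaps X Y"
    and "\<And>x. x \<in> topspace X \<Longrightarrow> f x \<in> topspace Y"
    and generic: "\<And>x. x \<in> topspace X \<Longrightarrow> generic_in Y ((\<lambda>g. g x) ` A) (f x)"
  shows "continuous_map X Y f"
  unfolding continuous_map_def
proof (intro conjI allI impI funcsetI)
  show "f x \<in> topspace Y" if "x \<in> topspace X" for x
    using assms(2) that .
  fix U assume U: "openin Y U"
  \<comment> \<open>Genericity of \<open>f x\<close> says that \<open>f x\<close> lies in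
    \<open>U\<close> exactly when some \<open>g\<close> in \<open>A\<close> has its value at
    \<open>x\<close> in \<open>U\<close>.\<close>
  have "{x \<in> topspace X. f x \<in> U} = (\<Union>g\<in>A. {x \<in> topspace X. g x \<in> U})"
    using generic U by (auto simp: generic_in_def)
  moreover have "openin X {x \<in> topspace X. g x \<in> U}" if "g \<in> A" for g
    using that assms(1) U by (auto simp: cmaps_def intro: openin_continuous_map_preimage)
  ultimately show "openin X {x \<in> topspace X. f x \<in> U}"
    by auto
qed

lemma generic_in_pointwise_topology:
  assumes A: "irreducible_in (pointwise_topology X Y) A" and f: "f \<in> cmaps X Y"
    and generic: "\<And>x. x \<in> topspace X \<Longrightarrow> generic_in Y ((\<lambda>g. g x) ` A) (f x)"
  shows "generic_in (pointwise_topology X Y) A f"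
  unfolding generic_in_def
proof (intro allI impI)
  have A': "A \<subseteq> cmaps X Y" "A \<noteq> {}"
    using A by (auto simp: irreducible_in_def)
  fix W assume "openin (pointwise_topology X Y) W"
  then show "f \<in> W \<longleftrightarrow> A \<inter> W \<noteq> {}"
  proof (induction rule: openin_pointwise_topology_induct)
    case (Subbasis x U)
    then show ?case
      using generic [of x] f A'(1) by (auto simp: generic_in_def)
  next
    case Space
    then show ?case
      using f A' by blast
  next
    \<comment> \<open>If \<open>f\<close> lies in both sets, then \<open>A\<close> meets each of
      them, and irreducibility makes it meet the intersection. The converse is immediate.\<close>
    case (Int S T)
    then show ?case
      using irreducible_in_openin_Int [OF A] by blast
  next
    case (Union \<S>)
    then show ?case
      by blast
  qed
qed

section \<open>R-subset systems and sobriety\<close>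

lemma R_subset_system_irreducible:
  assumes "R_subset_system H Hm" "t0_space X" "A \<in> H X"
  shows "irreducible_in X A"
proof -
  have "H X \<subseteq> Irr X"
    using assms(1,2) unfolding R_subset_system_def by (elim conjE) blast
  then show ?thesis
    using assms(3) by (auto simp: Irr_def)
qed

lemma R_subset_system_image:
  assumes "R_subset_system H Hm" "t0_space X" "t0_space Y" "continuous_map X Y f" "A \<in> H X"
  shows "f ` A \<in> H Y"
proof -
  have "\<forall>X Y f. t0_space X \<and> t0_space Y \<and> continuous_map X Y f \<longrightarrow>
      (\<forall>A\<in>H X. Hm X Y f A = f ` A \<and> f ` A \<in> H Y)"
    using assms(1) unfolding R_subset_system_def by (elim conjE)
  then show ?thesis
    using assms(2-) by blast
qed

lemma H_sober_iff_generic_in: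
  assumes "R_subset_system H Hm" "t0_space X"
  shows "H_sober H X \<longleftrightarrow> (\<forall>A\<in>H X. \<exists>x\<in>topspace X. generic_in X A x)"
proof -
  have "A \<subseteq> topspace X" if "A \<in> H X" for A
    by (rule irreducible_in_subset [OF R_subset_system_irreducible [OF assms that]])
  then have "generic_in X A x \<longleftrightarrow> X closure_of A = X closure_of {x}"
    if "A \<in> H X" "x \<in> topspace X" for A x
    using generic_in_iff_closure_of that by metis
  then show ?thesis
    unfolding H_sober_def using assms(2) by (simp only: simp_thms cong: ball_cong bex_cong)
qed

text \<open>Push \<open>A\<close> forward along the section \<open>s\<close>, take a generic point
  there and bring it back along \<open>r\<close>; the composite fixes \<open>A\<close>.\<close>

lemma H_sober_retract:
  assumes H: "R_subset_system H Hm" and "t0_space X" "t0_space Y"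
    and r: "continuous_map X Y r" and s: "continuous_map Y X s"
    and rs: "\<And>y. y \<in> topspace Y \<Longrightarrow> r (s y) = y"
    and "H_sober H X"
  shows "H_sober H Y"
  unfolding H_sober_iff_generic_in [OF H \<open>t0_space Y\<close>]
proof
  fix A assume A: "A \<in> H Y"
  then have sub: "A \<subseteq> topspace Y"
    by (intro irreducible_in_subset R_subset_system_irreducible [OF H \<open>t0_space Y\<close>])
  have "s ` A \<in> H X"
    using R_subset_system_image [OF H \<open>t0_space Y\<close> \<open>t0_space X\<close> s A] .
  then obtain x where x: "x \<in> topspace X" "generic_in X (s ` A) x"
    using \<open>H_sober H X\<close> H_sober_iff_generic_in [OF H \<open>t0_space X\<close>] by blast
  have "generic_in Y (r ` s ` A) (r x)"
    using generic_in_continuous_image [OF r x(1) _ x(2)] s sub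
    by (auto simp: continuous_map_def)
  moreover have "r ` s ` A = A"
    using rs sub by (force simp: image_image)
  ultimately show "\<exists>y\<in>topspace Y. generic_in Y A y"
    using r x(1) by (auto simp: continuous_map_def)
qed

text \<open>\<open>H\<close> acts on topologies over \<open>'u\<close>, while the function space
  lives over \<open>'u \<Rightarrow> 'u\<close>; hence the homeomorphic copy \<open>C\<close>. A
  point of \<open>X\<close> is required for evaluation: over an empty \<open>X\<close> the function
  space is a single point, which is sober for any \<open>Y\<close>.\<close>

theorem corollary4p12:
  fixes H :: "'u topology \<Rightarrow> 'u set set"
    and Hm :: "'u topology \<Rightarrow> 'u topology \<Rightarrow> ('u \<Rightarrow> 'u) \<Rightarrow> 'u set \<Rightarrow> 'u set"
    and X Y C :: "'u topology"
  assumes "R_subset_system H Hm"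
    and "t0_space X" and "topspace X \<noteq> {}"
    and "t0_space Y"
    and "C homeomorphic_space pointwise_topology X Y"
  shows "H_sober H Y \<longleftrightarrow> H_sober H C"
proof
  let ?P = "pointwise_topology X Y"
  note H = assms(1) and Y = assms(4)
  obtain h k where hk: "homeomorphic_maps C ?P h k"
    using assms(5) by (auto simp: homeomorphic_space_def)
  then have h: "continuous_map C ?P h" and k: "continuous_map ?P C k"
    and kh: "\<And>c. c \<in> topspace C \<Longrightarrow> k (h c) = c"
    and hk': "\<And>f. f \<in> cmaps X Y \<Longrightarrow> h (k f) = f"
    by (auto simp: homeomorphic_maps_def)
  have C: "t0_space C"
    using t0_space_pointwise_topology [OF Y] homeomorphic_t0_space [OF assms(5)] by simp
  have eval: "continuous_map C Y (\<lambda>c. h c x)" if "x \<in> topspace X" for x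
    using continuous_map_compose [OF h continuous_map_pointwise_eval [OF that]]
    by (simp add: o_def)
  {
    assume "H_sober H C"
    obtain x where x: "x \<in> topspace X"
      using assms(3) by blast
    let ?c = "\<lambda>y. \<lambda>x\<in>topspace X. y"
    show "H_sober H Y"
    \<comment> \<open>The retraction evaluates at the fixed \<open>x\<close>; the section sends
      \<open>y\<close> to the constant map, moved into \<open>C\<close> by \<open>k\<close>.\<close>
    proof (rule H_sober_retract [OF H C Y eval [OF x] _ _ \<open>H_sober H C\<close>])
      show "continuous_map Y C (\<lambda>y. k (?c y))"
        using continuous_map_compose [OF continuous_map_pointwise_const k] by (simp add: o_def)
      show "h (k (?c y)) x = y" if "y \<in> topspace Y" for y
      proof -
        have "?c y \<in> cmaps X Y"
          using continuous_map_pointwise_const [of Y X] that by (auto simp: continuous_map_def)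
        then show ?thesis
          using hk' x by simp
      qed
    qed
  }
  assume "H_sober H Y"
  show "H_sober H C"
    unfolding H_sober_iff_generic_in [OF H C]
  proof
    fix A assume A: "A \<in> H C"
    then have "irreducible_in C A"
      by (rule R_subset_system_irreducible [OF H C])
    \<comment> \<open>Only irreducibility is carried to the image of \<open>A\<close> under
      \<open>h\<close>, since \<open>H\<close> cannot be applied to \<open>?P\<close>.\<close>
    then have sub: "A \<subseteq> topspace C" and irr: "irreducible_in ?P (h ` A)"
      using irreducible_in_continuous_image [OF h] irreducible_in_subset by blast+
    then have hA: "h ` A \<subseteq> cmaps X Y"
      using irreducible_in_subset by fastforce
    have "\<exists>y\<in>topspace Y. generic_in Y ((\<lambda>g. g x) ` h ` A) y" if "x \<in> topspace X" for x
    proof -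
      \<comment> \<open>Evaluation is taken directly from \<open>C\<close>, so that both spaces lie
        in the universe of \<open>H\<close>.\<close>
      have "(\<lambda>c. h c x) ` A \<in> H Y"
        using R_subset_system_image [OF H C Y eval [OF that] A] .
      then show ?thesis
        using \<open>H_sober H Y\<close> H_sober_iff_generic_in [OF H Y] by (simp add: image_image)
    qed
    then obtain f0 where f0: "\<And>x. x \<in> topspace X \<Longrightarrow>
        f0 x \<in> topspace Y \<and> generic_in Y ((\<lambda>g. g x) ` h ` A) (f0 x)"
      by metis
    \<comment> \<open>The chosen \<open>f0\<close> is arbitrary off \<open>topspace X\<close>;
      restricting it gives the representative that \<open>cmaps\<close> demands.\<close>
    define f where "f = restrict f0 (topspace X)"
    have f: "f x \<in> topspace Y" "generic_in Y ((\<lambda>g. g x) ` h ` A) (f x)"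
      if "x \<in> topspace X" for x
      using f0 that by (auto simp: f_def)
    have "f \<in> extensional (topspace X)"
      by (simp add: f_def)
    then have fc: "f \<in> cmaps X Y"
      using continuous_map_pointwise_generic [OF hA f] by (simp add: cmaps_def)
    have "generic_in ?P (h ` A) f"
      by (rule generic_in_pointwise_topology [OF irr fc f(2)])
    \<comment> \<open>Genericity returns to \<open>C\<close> along the inverse
      homeomorphism.\<close>
    then have "generic_in C (k ` h ` A) (k f)"
      by (rule generic_in_continuous_image [OF k, rotated 2])
        (simp_all only: topspace_pointwise_topology fc hA)
    moreover have "k ` h ` A = A"
      using kh sub by (force simp: image_image)
    moreover have "k f \<in> topspace C"
      using k fc by (auto simp: continuous_map_def)
    ultimately show "\<exists>c\<in>topspace C. generic_in C A c"
      by auto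
  qed
qed

end
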